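(* Suppose $\gamma_n=0$ for all $n$ (i.e. $\alpha_n+\beta_n=1$), $E\varepsilon_0^2=1$, $E|\varepsilon_0|^{4+\delta}<\infty$ for some $\delta>0$, and, as $n\to\infty$, $n^{1/2}\alpha_n\to0$ and $n\alpha_n\to\infty$. Let $N\ge1$ be a fixed integer and $0<t_1<t_2<\cdots<t_N\le1$. Then the random variables $$(\omega[nt_m])^{-1/2}y_{[nt_m]},\qquad 1\le m\le N,$$ are asymptotically independent, each with asymptotic distribution equal to the distribution of $\varepsilon_0$; that is, as $n\to\infty$ they converge jointly in distribution to a vector of $N$ independent copies of $\varepsilon_0$.
   Context: Let $\varepsilon_0,\varepsilon_1,\varepsilon_2,\dots$ be independent identically distributed real random variables (not necessarily of mean zero) such that the distribution of $\varepsilon_0^2$ is nondegenerate. Let $\omega>0$ be a constant. For each $n\ge1$ let $\alpha=\alpha_n\ge0$ and $\beta=\beta_n\ge0$ be real numbers with $\alpha_n\to0$ and $\beta_n\to1$ as $n\to\infty$. Given an initial value $\sigma_0$ (a fixed real number not depending on $n$) and $y_0=\sigma_0\varepsilon_0$, define for each $n$ the sequences $\sigma_k\ge 0$ and $y_k$, $1\le k\le n$ (which depend on $n$ through $\alpha_n,\beta_n$), by $y_k=\sigma_k\varepsilon_k$ and $\sigma_k^2=\omega+\alpha y_{k-1}^2+\beta\sigma_{k-1}^2$. Put $\gamma=\gamma_n=\alpha_n+\beta_n-1$. $[x]$ denotes the integer part of $x$. *)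

theory Defs
  imports "HOL-Probability.Probability"
begin

text \<open>
  The volatility \<open>\<sigma>\<^sub>k\<close> of a GARCH(1,1) sequence driven by the innovations \<open>e\<close>. Since \<open>\<sigma>\<^sub>k \<ge> 0\<close>
  for \<open>k \<ge> 1\<close>, the recursion \<open>\<sigma>\<^sub>k\<^sup>2 = \<omega> + a y\<^sub>k\<^sub>-\<^sub>1\<^sup>2 + b \<sigma>\<^sub>k\<^sub>-\<^sub>1\<^sup>2\<close> with \<open>y\<^sub>k = \<sigma>\<^sub>k e\<^sub>k\<close> determines
  \<open>\<sigma>\<^sub>k\<close> as the square root. The initial value \<open>s0\<close> may have either sign.
\<close>

primrec garch_sigma :: "real \<Rightarrow> real \<Rightarrow> real \<Rightarrow> real \<Rightarrow> (nat \<Rightarrow> real) \<Rightarrow> nat \<Rightarrow> real" where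
  "garch_sigma \<omega> a b s0 e 0 = s0"
| "garch_sigma \<omega> a b s0 e (Suc k) =
     sqrt (\<omega> + a * (garch_sigma \<omega> a b s0 e k * e k)\<^sup>2 + b * (garch_sigma \<omega> a b s0 e k)\<^sup>2)"

definition garch_y :: "real \<Rightarrow> real \<Rightarrow> real \<Rightarrow> real \<Rightarrow> (nat \<Rightarrow> real) \<Rightarrow> nat \<Rightarrow> real" where
  "garch_y \<omega> a b s0 e k = garch_sigma \<omega> a b s0 e k * e k"

text \<open>
  Weak convergence of measures on the space of a topology \<open>T\<close>, by bounded continuous test functions.
  It is meant for measures on the Borel sets of \<open>T\<close>. For vectors indexed by a finite set \<open>I\<close>,
  \<open>T\<close> is the product topology on the extensional functions \<open>I \<rightarrow>\<^sub>E UNIV\<close>, a copy of the Euclidean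
  space with coordinates in \<open>I\<close>, whose Borel sets are those of \<open>\<Pi>\<^sub>M i\<in>I. borel\<close>. 
\<close>

definition weak_conv_in :: "'b topology \<Rightarrow> (nat \<Rightarrow> 'b measure) \<Rightarrow> 'b measure \<Rightarrow> bool" where
  "weak_conv_in T \<mu> \<nu> \<longleftrightarrow>
     (\<forall>f :: 'b \<Rightarrow> real. continuous_map T euclideanreal f \<and> bounded (f ` topspace T) \<longrightarrow>
        (\<lambda>n. \<integral>x. f x \<partial>\<mu> n) \<longlonglongrightarrow> (\<integral>x. f x \<partial>\<nu>))"

end

theory Submission
  imports Defs
begin

text \<open>
  Since \<open>\<alpha> + \<beta> = 1\<close>, the recursion reads
  \<open>\<sigma>\<^sub>k\<^sub>+\<^sub>1\<^sup>2 = \<omega> + \<sigma>\<^sub>k\<^sup>2 + \<alpha> \<sigma>\<^sub>k\<^sup>2 (\<epsilon>\<^sub>k\<^sup>2 - 1)\<close>, so \<open>\<sigma>\<^sub>k\<^sup>2 - \<omega> k\<close> is a martingale whose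
  increments are of order \<open>\<alpha> k\<close>. As \<open>n \<alpha>\<^sub>n\<^sup>2 \<rightarrow> 0\<close>, its variance at time \<open>k \<le> n\<close> is \<open>o(n\<^sup>2)\<close>, hence
  \<open>\<sigma>\<^sub>k / sqrt (\<omega> k) \<rightarrow> 1\<close> in mean square for \<open>k = [n t]\<close>. By independence of \<open>\<sigma>\<^sub>k\<close> and \<open>\<epsilon>\<^sub>k\<close> the normalised
  vector differs from the innovations at the times \<open>[n t\<^sub>m]\<close> by a vector that tends to zero in mean square, and for large \<open>n\<close>
  these times are distinct, so that the vector of innovations has the limit law exactly.
\<close>

section \<open>Continuous functions of finite vectors and perturbation of weak limits\<close>

lemma continuous_on_restrict_arg:
  fixes f :: "('i \<Rightarrow> real) \<Rightarrow> real"
  assumes "continuous_map (product_topology (\<lambda>_. euclideanreal) I) euclideanreal f"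
  shows "continuous_on UNIV (\<lambda>z. f (restrict z I))"
proof -
  \<comment> \<open>Precomposing with restriction moves \<open>f\<close> to the full function type,
    where the type-class topology, its Borel sets and its metric are available.\<close>
  have "continuous_map (product_topology (\<lambda>_. euclideanreal) UNIV)
      (product_topology (\<lambda>_. euclideanreal) I) (\<lambda>z. restrict z I)"
    by (subst continuous_map_componentwise) (auto intro: continuous_map_product_projection)
  then have "continuous_map euclidean (product_topology (\<lambda>_. euclideanreal) I) (\<lambda>z. restrict z I)"
    by (simp add: euclidean_product_topology)
  from continuous_map_compose[OF this assms] show ?thesis
    by (simp add: o_def)
qed

text \<open>Over a countable index type the product sigma-algebra on \<open>UNIV\<close> is the
  Borel one, so continuity gives measurability there. The result is pulled back along extension by
  zero, which restriction to \<open>I\<close> undoes.\<close>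

lemma borel_measurable_continuous_map_PiM:
  fixes f :: "('i::countable \<Rightarrow> real) \<Rightarrow> real"
  assumes "continuous_map (product_topology (\<lambda>_. euclideanreal) I) euclideanreal f"
  shows "f \<in> borel_measurable (\<Pi>\<^sub>M i\<in>I. borel)"
proof -
  have F: "(\<lambda>z. f (restrict z I)) \<in> borel_measurable (\<Pi>\<^sub>M i\<in>UNIV. borel)"
    using borel_measurable_continuous_onI[OF continuous_on_restrict_arg[OF assms]]
    by (simp add: measurable_def sets_PiM_equal_borel space_PiM)
  have "(\<lambda>z i. if i \<in> I then z i else 0) \<in> (\<Pi>\<^sub>M i\<in>I. (borel :: real measure)) \<rightarrow>\<^sub>M (\<Pi>\<^sub>M i\<in>UNIV. borel)"
  proof (rule measurable_PiM_single')
    show "(\<lambda>z. if i \<in> I then z i else 0) \<in> borel_measurable (\<Pi>\<^sub>M i\<in>I. (borel :: real measure))" for i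
      by (cases "i \<in> I") simp_all
  qed auto
  from measurable_compose[OF this F]
  have "(\<lambda>z. f (restrict (\<lambda>i. if i \<in> I then z i else 0) I)) \<in> borel_measurable (\<Pi>\<^sub>M i\<in>I. borel)" .
  moreover have "restrict (\<lambda>i. if i \<in> I then z i else 0) I = z"
    if "z \<in> space (\<Pi>\<^sub>M i\<in>I. (borel :: real measure))" for z :: "'i \<Rightarrow> real"
    using that by (auto simp: space_PiM PiE_def extensional_def fun_eq_iff)
  ultimately show ?thesis
    by (simp cong: measurable_cong)
qed

text \<open>A box is compact by Tychonoff's theorem, so the Heine-Cantor theorem applies. It remains
  to replace the metric of the function space by coordinatewise bounds on \<open>I\<close>.\<close>

lemma uniformly_continuous_on_box:
  fixes f :: "('i::countable \<Rightarrow> real) \<Rightarrow> real"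
  assumes f: "continuous_map (product_topology (\<lambda>_. euclideanreal) I) euclideanreal f"
    and "e > 0"
  obtains d where "d > 0"
    "\<And>x y. \<lbrakk>\<And>i. i \<in> I \<Longrightarrow> \<bar>x i\<bar> \<le> L; \<And>i. i \<in> I \<Longrightarrow> \<bar>y i\<bar> \<le> L;
        \<And>i. i \<in> I \<Longrightarrow> \<bar>y i - x i\<bar> \<le> d\<rbrakk> \<Longrightarrow> \<bar>f (restrict y I) - f (restrict x I)\<bar> < e"
proof -
  \<comment> \<open>The absolute value keeps 0 in each interval whatever the sign of
    \<open>L\<close>; points are extended by zero outside \<open>I\<close>.\<close>
  define S :: "('i \<Rightarrow> real) set" where "S = (\<Pi>\<^sub>E i\<in>UNIV. {-\<bar>L\<bar>..\<bar>L\<bar>})"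
  have "compactin (product_topology (\<lambda>_. euclideanreal) UNIV) S"
    unfolding S_def by (subst compactin_PiE) simp
  then have "compact S"
    by (simp add: euclidean_product_topology)
  then have "uniformly_continuous_on S (\<lambda>z. f (restrict z I))"
    by (intro compact_uniformly_continuous continuous_on_subset[OF continuous_on_restrict_arg[OF f]])
      simp_all
  then obtain \<eta> where "\<eta> > 0"
    and \<eta>: "\<And>x y. x \<in> S \<Longrightarrow> y \<in> S \<Longrightarrow> dist y x < \<eta> \<Longrightarrow>
      dist (f (restrict y I)) (f (restrict x I)) < e"
    using \<open>e > 0\<close> unfolding uniformly_continuous_on_def by meson
  \<comment> \<open>The distance of two functions is at most twice the largest gap over the first
    coordinates, up to \<open>n\<close>, plus \<open>(1/2) ^ n\<close>. Gaps of at most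
    \<open>\<eta> / 4\<close> thus give a distance below \<open>\<eta>\<close>.\<close>
  obtain n where n: "(1/2::real) ^ n < \<eta> / 2"
    using real_arch_pow_inv[of "\<eta>/2" "1/2"] \<open>\<eta> > 0\<close> by auto
  show thesis
  proof (rule that)
    show "\<eta> / 4 > 0" using \<open>\<eta> > 0\<close> by simp
    fix x y :: "'i \<Rightarrow> real"
    assume xy: "\<And>i. i \<in> I \<Longrightarrow> \<bar>x i\<bar> \<le> L" "\<And>i. i \<in> I \<Longrightarrow> \<bar>y i\<bar> \<le> L"
      "\<And>i. i \<in> I \<Longrightarrow> \<bar>y i - x i\<bar> \<le> \<eta> / 4"
    define x' y' where "x' = (\<lambda>i. if i \<in> I then x i else 0)"
      and "y' = (\<lambda>i. if i \<in> I then y i else 0)"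
    have *: "dist (y' i) (x' i) \<le> \<eta> / 4" for i
      using xy(3)[of i] \<open>\<eta> > 0\<close> by (auto simp: x'_def y'_def dist_real_def)
    have "Max {dist (y' (from_nat k)) (x' (from_nat k)) |k. k \<le> n} \<le> \<eta> / 4"
      using * by (intro Max.boundedI) auto
    then have "dist y' x' < \<eta>"
      using dist_fun_le_dist_first_terms[of y' x' n] n by linarith
    moreover have box: "\<bar>x' i\<bar> \<le> \<bar>L\<bar>" "\<bar>y' i\<bar> \<le> \<bar>L\<bar>" for i
      using xy(1,2)[of i] by (auto simp: x'_def y'_def)
    moreover have "x' \<in> S" "y' \<in> S"
      using box by (auto simp: S_def abs_le_iff minus_le_iff)
    moreover have "restrict x' I = restrict x I" "restrict y' I = restrict y I"
      by (auto simp: x'_def y'_def)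
    ultimately show "\<bar>f (restrict y I) - f (restrict x I)\<bar> < e"
      using \<eta>[of x' y'] by (simp add: dist_real_def)
  qed
qed

text \<open>A pointwise form of Chebyshev's inequality: either all coordinates are moderate and
  close, and uniform continuity gives \<open>e\<close>, or some summand is at least 1 and the crude
  bound \<open>2 * B\<close> suffices. Integrating it leaves only second moments to control.\<close>

lemma perturbation_bound:
  fixes f :: "('i::countable \<Rightarrow> real) \<Rightarrow> real"
  assumes f: "continuous_map (product_topology (\<lambda>_. euclideanreal) I) euclideanreal f"
    and B: "\<And>z. z \<in> extensional I \<Longrightarrow> \<bar>f z\<bar> \<le> B"
    and "finite I" "e > 0" "K > 0"
  obtains d where "d > 0"
    "\<And>x y. \<bar>f (restrict y I) - f (restrict x I)\<bar>
       \<le> e + 2 * B * (\<Sum>i\<in>I. (x i)\<^sup>2 / K\<^sup>2 + (y i - x i)\<^sup>2 / d\<^sup>2)"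
proof -
  \<comment> \<open>The margin 1 around \<open>K\<close> keeps \<open>y\<close> in the box as well,
    since \<open>d\<close> will be at most 1.\<close>
  obtain d0 where "d0 > 0" and d0: "\<And>x y. \<lbrakk>\<And>i. i \<in> I \<Longrightarrow> \<bar>x i\<bar> \<le> K + 1;
      \<And>i. i \<in> I \<Longrightarrow> \<bar>y i\<bar> \<le> K + 1; \<And>i. i \<in> I \<Longrightarrow> \<bar>y i - x i\<bar> \<le> d0\<rbrakk>
      \<Longrightarrow> \<bar>f (restrict y I) - f (restrict x I)\<bar> < e"
    using uniformly_continuous_on_box[OF f \<open>e > 0\<close>, of "K + 1"] by metis
  define d where "d = min d0 1"
  have "d > 0" "d \<le> d0" "d \<le> 1" using \<open>d0 > 0\<close> by (auto simp: d_def)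
  have "B \<ge> 0" using B[of "restrict (\<lambda>_. 0) I"] by fastforce
  have "\<bar>f (restrict y I) - f (restrict x I)\<bar>
      \<le> e + 2 * B * (\<Sum>i\<in>I. (x i)\<^sup>2 / K\<^sup>2 + (y i - x i)\<^sup>2 / d\<^sup>2)" (is "?l \<le> _ + _ * ?s")
    for x y
  proof (cases "\<forall>i\<in>I. \<bar>x i\<bar> \<le> K \<and> \<bar>y i - x i\<bar> \<le> d")
    case True
    have "\<bar>x i\<bar> \<le> K + 1" "\<bar>y i\<bar> \<le> K + 1" "\<bar>y i - x i\<bar> \<le> d0" if "i \<in> I" for i
    proof -
      have "\<bar>x i\<bar> \<le> K" "\<bar>y i - x i\<bar> \<le> d" using True that by auto
      then show "\<bar>x i\<bar> \<le> K + 1" "\<bar>y i\<bar> \<le> K + 1" "\<bar>y i - x i\<bar> \<le> d0"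
        using \<open>d \<le> 1\<close> \<open>d \<le> d0\<close> by linarith+
    qed
    then have "?l < e" by (rule d0)
    moreover have "0 \<le> 2 * B * ?s"
      using \<open>B \<ge> 0\<close> by (intro mult_nonneg_nonneg sum_nonneg) auto
    ultimately show ?thesis by simp
  next
    case False
    then obtain i where i: "i \<in> I" "K < \<bar>x i\<bar> \<or> d < \<bar>y i - x i\<bar>"
      using not_le by blast
    have "1 \<le> (x i)\<^sup>2 / K\<^sup>2 + (y i - x i)\<^sup>2 / d\<^sup>2"
      using i(2)
    proof
      assume "K < \<bar>x i\<bar>"
      then have "K\<^sup>2 \<le> (x i)\<^sup>2" using \<open>K > 0\<close> by (metis abs_le_square_iff abs_of_pos less_imp_le)
      then have "1 \<le> (x i)\<^sup>2 / K\<^sup>2" using \<open>K > 0\<close> by simp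
      then show ?thesis by (rule add_increasing2[rotated]) simp
    next
      assume "d < \<bar>y i - x i\<bar>"
      then have "d\<^sup>2 \<le> (y i - x i)\<^sup>2" using \<open>d > 0\<close> by (metis abs_le_square_iff abs_of_pos less_imp_le)
      then have "1 \<le> (y i - x i)\<^sup>2 / d\<^sup>2" using \<open>d > 0\<close> by simp
      then show ?thesis by (rule add_increasing[rotated]) simp
    qed
    also have "\<dots> \<le> ?s"
      by (rule member_le_sum) (use i \<open>finite I\<close> in auto)
    finally have "2 * B \<le> 2 * B * ?s"
      using \<open>B \<ge> 0\<close> mult_left_mono[of 1 ?s "2 * B"] by simp
    moreover have "?l \<le> 2 * B"
      using B[of "restrict x I"] B[of "restrict y I"] by fastforce
    ultimately show ?thesis using \<open>e > 0\<close> by linarith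
  qed
  with \<open>d > 0\<close> show thesis by (rule that)
qed

text \<open>A Slutsky argument in mean square. The law of \<open>X n\<close> and the integrability
  of the difference are only required eventually, because for small \<open>n\<close> the sampling
  times may coincide or be 0.\<close>

lemma (in prob_space) weak_conv_in_L2_perturbation:
  fixes X Y :: "nat \<Rightarrow> 'i::countable \<Rightarrow> 'a \<Rightarrow> real"
  assumes "finite I"
    and [measurable]: "\<And>n i. i \<in> I \<Longrightarrow> X n i \<in> borel_measurable M"
      "\<And>n i. i \<in> I \<Longrightarrow> Y n i \<in> borel_measurable M"
    and law: "\<forall>\<^sub>F n in sequentially. distr M (\<Pi>\<^sub>M i\<in>I. borel) (\<lambda>x. \<lambda>i\<in>I. X n i x) = \<nu>"
    and X2: "\<And>n i. i \<in> I \<Longrightarrow> integrable M (\<lambda>x. (X n i x)\<^sup>2)"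
      "\<And>n i. i \<in> I \<Longrightarrow> expectation (\<lambda>x. (X n i x)\<^sup>2) \<le> C"
    and D2: "\<forall>\<^sub>F n in sequentially. \<forall>i\<in>I. integrable M (\<lambda>x. (Y n i x - X n i x)\<^sup>2)"
      "\<And>i. i \<in> I \<Longrightarrow> (\<lambda>n. expectation (\<lambda>x. (Y n i x - X n i x)\<^sup>2)) \<longlonglongrightarrow> 0"
  shows "weak_conv_in (product_topology (\<lambda>_. euclideanreal) I)
    (\<lambda>n. distr M (\<Pi>\<^sub>M i\<in>I. borel) (\<lambda>x. \<lambda>i\<in>I. Y n i x)) \<nu>"
  unfolding weak_conv_in_def
proof (intro allI impI, elim conjE)
  fix f :: "('i \<Rightarrow> real) \<Rightarrow> real"
  assume f: "continuous_map (product_topology (\<lambda>_. euclideanreal) I) euclideanreal f"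
    and "bounded (f ` topspace (product_topology (\<lambda>_. euclideanreal) I))"
  then obtain B where B: "\<bar>f z\<bar> \<le> B" if "z \<in> extensional I" for z
    by (auto simp: bounded_iff PiE_def)
  have "B \<ge> 0" using B[of "restrict (\<lambda>_. 0) I"] by fastforce
  note [measurable] = borel_measurable_continuous_map_PiM[OF f]
  define g where "g Z x = f (\<lambda>i\<in>I. Z i x)" for Z :: "'i \<Rightarrow> 'a \<Rightarrow> real" and x
  have meas [measurable]: "g (X n) \<in> borel_measurable M" "g (Y n) \<in> borel_measurable M" for n
    unfolding g_def by measurable
  have int: "integrable M (g (X n))" "integrable M (g (Y n))" for n
    by (intro integrable_const_bound[where B=B]; auto simp: g_def B)+
  have distr_eq: "(\<integral>z. f z \<partial>distr M (\<Pi>\<^sub>M i\<in>I. borel) (\<lambda>x. \<lambda>i\<in>I. X n i x)) = expectation (g (X n))"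
    "(\<integral>z. f z \<partial>distr M (\<Pi>\<^sub>M i\<in>I. borel) (\<lambda>x. \<lambda>i\<in>I. Y n i x)) = expectation (g (Y n))" for n
    unfolding g_def by (subst integral_distr; measurable)+
  have "(\<lambda>n. expectation (g (Y n)) - expectation (g (X n))) \<longlonglongrightarrow> 0"
  proof (rule LIMSEQ_I)
    fix r :: real assume "r > 0"
    \<comment> \<open>The tolerance is split in three: uniform continuity, the truncation term
      \<open>c / K\<^sup>2\<close>, and the mean square difference. \<open>K\<close> is fixed first,
      then \<open>d\<close> depending on \<open>K\<close>, then \<open>n\<close>. The summand 1 in
      \<open>c + 1\<close> keeps \<open>K\<close> positive when \<open>c = 0\<close>.\<close>
    define c where "c = 2 * B * card I * \<bar>C\<bar>"
    define K where "K = sqrt (3 * (c + 1) / r)"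
    have "c \<ge> 0" using \<open>B \<ge> 0\<close> by (simp add: c_def)
    then have "K > 0" "K\<^sup>2 = 3 * (c + 1) / r" using \<open>r > 0\<close> by (auto simp: K_def)
    then have K: "c / K\<^sup>2 < r / 3" using \<open>r > 0\<close> \<open>c \<ge> 0\<close> by (simp add: field_simps)
    obtain d where "d > 0" and d: "\<And>x y. \<bar>f (restrict y I) - f (restrict x I)\<bar>
       \<le> r / 3 + 2 * B * (\<Sum>i\<in>I. (x i)\<^sup>2 / K\<^sup>2 + (y i - x i)\<^sup>2 / d\<^sup>2)"
      using perturbation_bound[OF f B \<open>finite I\<close>, of "r / 3" K] \<open>r > 0\<close> \<open>K > 0\<close> by auto
    have "(\<lambda>n. 2 * B * (\<Sum>i\<in>I. expectation (\<lambda>x. (Y n i x - X n i x)\<^sup>2) / d\<^sup>2)) \<longlonglongrightarrow> 2 * B * (\<Sum>i\<in>I. 0 / d\<^sup>2)"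
      using \<open>d > 0\<close> by (intro tendsto_intros D2) auto
    then have "\<forall>\<^sub>F n in sequentially. 2 * B * (\<Sum>i\<in>I. expectation (\<lambda>x. (Y n i x - X n i x)\<^sup>2) / d\<^sup>2) < r / 3"
      using \<open>r > 0\<close> by (intro order_tendstoD(2)[where a="r/3"]) auto
    with D2(1) have "\<forall>\<^sub>F n in sequentially. \<bar>expectation (g (Y n)) - expectation (g (X n))\<bar> < r"
    proof eventually_elim
      case (elim n)
      have "\<bar>expectation (g (Y n)) - expectation (g (X n))\<bar> = \<bar>expectation (\<lambda>x. g (Y n) x - g (X n) x)\<bar>"
        using int by simp
      also have "\<dots> \<le> expectation (\<lambda>x. \<bar>g (Y n) x - g (X n) x\<bar>)"
        by (rule integral_abs_bound)
      also have "\<dots> \<le> expectation (\<lambda>x. r / 3 + 2 * B *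
          (\<Sum>i\<in>I. (X n i x)\<^sup>2 / K\<^sup>2 + (Y n i x - X n i x)\<^sup>2 / d\<^sup>2))"
      proof (rule integral_mono)
        show "integrable M (\<lambda>x. \<bar>g (Y n) x - g (X n) x\<bar>)"
          using int by simp
        show "integrable M (\<lambda>x. r / 3 + 2 * B *
            (\<Sum>i\<in>I. (X n i x)\<^sup>2 / K\<^sup>2 + (Y n i x - X n i x)\<^sup>2 / d\<^sup>2))"
          using X2(1) elim(1) by simp
      qed (use d in \<open>auto simp: g_def\<close>)
      also have "\<dots> = r / 3 + 2 * B * (\<Sum>i\<in>I. expectation (\<lambda>x. (X n i x)\<^sup>2) / K\<^sup>2)
          + 2 * B * (\<Sum>i\<in>I. expectation (\<lambda>x. (Y n i x - X n i x)\<^sup>2) / d\<^sup>2)"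
        using X2(1) elim(1)
        by (simp add: Bochner_Integration.integral_sum sum.distrib prob_space algebra_simps)
      also have "2 * B * (\<Sum>i\<in>I. expectation (\<lambda>x. (X n i x)\<^sup>2) / K\<^sup>2) \<le> 2 * B * (\<Sum>i\<in>I. \<bar>C\<bar> / K\<^sup>2)"
        using X2(2) \<open>B \<ge> 0\<close>
        by (intro mult_left_mono sum_mono divide_right_mono)
            (auto intro: order_trans[OF _ abs_ge_self])
      also have "\<dots> = c / K\<^sup>2" by (simp add: c_def)
      finally show ?case using K elim(2) by linarith
    qed
    then show "\<exists>no. \<forall>n\<ge>no. norm (expectation (g (Y n)) - expectation (g (X n)) - 0) < r"
      by (simp add: eventually_sequentially)
  qed
  moreover have "(\<lambda>n. expectation (g (X n))) \<longlonglongrightarrow> (\<integral>z. f z \<partial>\<nu>)"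
  proof (rule tendsto_eventually)
    show "\<forall>\<^sub>F n in sequentially. expectation (g (X n)) = (\<integral>z. f z \<partial>\<nu>)"
      using law by eventually_elim (metis distr_eq(1))
  qed
  ultimately have "(\<lambda>n. expectation (g (Y n))) \<longlonglongrightarrow> (\<integral>z. f z \<partial>\<nu>)"
    by (rule Lim_transform[rotated])
  then show "(\<lambda>n. \<integral>z. f z \<partial>distr M (\<Pi>\<^sub>M i\<in>I. borel) (\<lambda>x. \<lambda>i\<in>I. Y n i x)) \<longlonglongrightarrow> (\<integral>z. f z \<partial>\<nu>)"
    by (simp add: distr_eq)
qed

section \<open>The GARCH recursion and its moments when \<open>a + b = 1\<close>\<close>

lemma garch_sigma_nonneg: "k > 0 \<Longrightarrow> \<omega> \<ge> 0 \<Longrightarrow> a \<ge> 0 \<Longrightarrow> b \<ge> 0 \<Longrightarrow> garch_sigma \<omega> a b s0 e k \<ge> 0"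
  by (cases k) auto

lemma garch_sigma_square_Suc:
  assumes "\<omega> \<ge> 0" "a \<ge> 0" "b \<ge> 0"
  shows "(garch_sigma \<omega> a b s0 e (Suc k))\<^sup>2 =
    \<omega> + (garch_sigma \<omega> a b s0 e k)\<^sup>2 * (a * (e k)\<^sup>2 + b)"
  using assms by (simp add: power_mult_distrib algebra_simps)

lemma garch_sigma_cong:
  "(\<And>j. j < k \<Longrightarrow> e j = e' j) \<Longrightarrow> garch_sigma \<omega> a b s0 e k = garch_sigma \<omega> a b s0 e' k"
  by (induction k) auto

lemma measurable_garch_sigma:
  "(\<And>j. j < k \<Longrightarrow> e j \<in> borel_measurable M) \<Longrightarrow>
    (\<lambda>x. garch_sigma \<omega> a b s0 (\<lambda>j. e j x) k) \<in> borel_measurable M"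
proof (induction k)
  case (Suc k)
  from Suc have [measurable]: "(\<lambda>x. garch_sigma \<omega> a b s0 (\<lambda>j. e j x) k) \<in> borel_measurable M"
    "e k \<in> borel_measurable M" by simp_all
  show ?case unfolding garch_sigma.simps by measurable
qed simp

text \<open>One row of the triangular array: the coefficients are fixed, and the bounds are explicit
  in \<open>a\<close>, \<open>c\<close> and the horizon, so that they can be used when the
  coefficients vary with the horizon.\<close>

locale critical_garch = prob_space M for M :: "'a measure" +
  fixes e :: "nat \<Rightarrow> 'a \<Rightarrow> real" and \<omega> a b s0 c :: real
  assumes indep: "indep_vars (\<lambda>_. borel) e UNIV"
    and moments: "\<And>k. integrable M (\<lambda>x. (e k x)\<^sup>2)" "\<And>k. expectation (\<lambda>x. (e k x)\<^sup>2) = 1"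
      "\<And>k. integrable M (\<lambda>x. ((e k x)\<^sup>2 - 1)\<^sup>2)" "\<And>k. expectation (\<lambda>x. ((e k x)\<^sup>2 - 1)\<^sup>2) \<le> c"
    and coeffs: "\<omega> > 0" "a \<ge> 0" "b \<ge> 0" "a + b = 1"
begin

definition sig :: "nat \<Rightarrow> 'a \<Rightarrow> real" where
  "sig k x = garch_sigma \<omega> a b s0 (\<lambda>i. e i x) k"

text \<open>The subtracted terms are the mean of the squared volatility, so this is the martingale
  part, started at 0.\<close>

definition dev :: "nat \<Rightarrow> 'a \<Rightarrow> real" where
  "dev k x = (sig k x)\<^sup>2 - s0\<^sup>2 - \<omega> * real k"

lemma measurable_innovation [measurable]: "e k \<in> borel_measurable M"
  using indep unfolding indep_vars_def by auto

lemma measurable_sig [measurable]: "sig k \<in> borel_measurable M"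
  unfolding sig_def by (rule measurable_garch_sigma) measurable

lemma measurable_dev [measurable]: "dev k \<in> borel_measurable M"
  unfolding dev_def by measurable

text \<open>The volatility at time \<open>k\<close> is a function of the innovations with index
  below \<open>k\<close>, and disjoint blocks of an independent family are independent.\<close>

lemma indep_sig_innovation: "indep_var borel (sig k) borel (e k)"
proof -
  have *: "indep_var (PiM {..<k} (\<lambda>_. borel)) (\<lambda>x. restrict (\<lambda>i. e i x) {..<k})
      (PiM {k} (\<lambda>_. borel)) (\<lambda>x. restrict (\<lambda>i. e i x) {k})"
    using indep by (rule indep_var_restrict) auto
  have "(\<lambda>z. garch_sigma \<omega> a b s0 z k) \<in> borel_measurable (PiM {..<k} (\<lambda>_. borel))"
    by (rule measurable_garch_sigma[where e="\<lambda>j z. z j"]) simp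
  from indep_var_compose[OF * this
      measurable_component_singleton[of k "{k}"]]
  have "indep_var borel (\<lambda>x. garch_sigma \<omega> a b s0 (restrict (\<lambda>i. e i x) {..<k}) k) borel (e k)"
    by (simp add: o_def)
  moreover have "garch_sigma \<omega> a b s0 (restrict (\<lambda>i. e i x) {..<k}) k = sig k x" for x
    unfolding sig_def by (rule garch_sigma_cong) simp
  ultimately show ?thesis by simp
qed

lemma
  assumes [measurable]: "g \<in> borel_measurable borel" "h \<in> borel_measurable borel"
    and "integrable M (\<lambda>x. g (sig k x))" "integrable M (\<lambda>x. h (e k x))"
  shows integrable_sig_times_innovation: "integrable M (\<lambda>x. g (sig k x) * h (e k x) :: real)"
    and expectation_sig_times_innovation: "expectation (\<lambda>x. g (sig k x) * h (e k x)) =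
      expectation (\<lambda>x. g (sig k x)) * expectation (\<lambda>x. h (e k x))"
proof -
  have "indep_var borel (\<lambda>x. g (sig k x)) borel (\<lambda>x. h (e k x))"
    using indep_var_compose[OF indep_sig_innovation assms(1,2)] by (simp add: o_def)
  with assms show "integrable M (\<lambda>x. g (sig k x) * h (e k x) :: real)"
    and "expectation (\<lambda>x. g (sig k x) * h (e k x)) =
      expectation (\<lambda>x. g (sig k x)) * expectation (\<lambda>x. h (e k x))"
    by (auto intro: indep_var_integrable indep_var_lebesgue_integral)
qed

lemma dev_Suc: "dev (Suc k) x = dev k x + a * ((sig k x)\<^sup>2 * ((e k x)\<^sup>2 - 1))"
proof -
  have "(sig (Suc k) x)\<^sup>2 = \<omega> + (sig k x)\<^sup>2 * (a * (e k x)\<^sup>2 + b)"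
    using garch_sigma_square_Suc[of \<omega> a b s0 "\<lambda>i. e i x" k] coeffs by (simp add: sig_def)
  also have "a * (e k x)\<^sup>2 + b = 1 + a * ((e k x)\<^sup>2 - 1)"
    using coeffs by (simp add: algebra_simps)
  finally show ?thesis
    by (simp add: dev_def algebra_simps)
qed

lemma expectation_centered: "expectation (\<lambda>x. (e k x)\<^sup>2 - 1) = 0"
  using moments by (simp add: prob_space)

lemma square_sum_scaled:
  "(d + a' * (s * z))\<^sup>2 = d\<^sup>2 + 2 * a' * (d * s * z) + a'\<^sup>2 * (s\<^sup>2 * z\<^sup>2)" for d a' s z :: real
  by (simp add: power2_eq_square algebra_simps)

text \<open>The two claims need each other in one induction: the squared increment of
  \<open>dev\<close> contains the fourth power of \<open>sig\<close>, and that power is recovered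
  from the square of \<open>dev\<close> by adding back the deterministic mean.\<close>

lemma
  shows integrable_dev_square: "integrable M (\<lambda>x. (dev k x)\<^sup>2)"
    and integrable_sig_pow4: "integrable M (\<lambda>x. ((sig k x)\<^sup>2)\<^sup>2)"
proof (induction k)
  case 0
  { case 1 show ?case by (simp add: dev_def sig_def) }
  { case 2 show ?case by (simp add: sig_def) }
next
  case (Suc k)
  note S4 = \<open>integrable M (\<lambda>x. ((sig k x)\<^sup>2)\<^sup>2)\<close>
  have S2: "integrable M (\<lambda>x. (sig k x)\<^sup>2)"
    using S4 by (rule square_integrable_imp_integrable[rotated]) simp
  have xi: "integrable M (\<lambda>x. (e k x)\<^sup>2 - 1)" using moments by simp
  have 1: "integrable M (\<lambda>x. (dev k x * (sig k x)\<^sup>2) * ((e k x)\<^sup>2 - 1))"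
  proof -
    \<comment> \<open>With \<open>dev k\<close> written as a polynomial in \<open>sig k\<close>, the
      cross term is a function of \<open>sig k\<close> times a function of \<open>e k\<close>, as
      the product rule requires.\<close>
    have "integrable M (\<lambda>x. ((sig k x)\<^sup>2 - s0\<^sup>2 - \<omega> * real k) * (sig k x)\<^sup>2)"
      using S4 S2 by (simp add: left_diff_distrib flip: power2_eq_square)
    then show ?thesis unfolding dev_def
      by (intro integrable_sig_times_innovation[where h="\<lambda>z. z\<^sup>2 - 1"
          and g="\<lambda>s. (s\<^sup>2 - s0\<^sup>2 - \<omega> * real k) * s\<^sup>2"]) (use xi in auto)
  qed
  have 2: "integrable M (\<lambda>x. ((sig k x)\<^sup>2)\<^sup>2 * ((e k x)\<^sup>2 - 1)\<^sup>2)"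
    by (intro integrable_sig_times_innovation[where h="\<lambda>z. (z\<^sup>2 - 1)\<^sup>2" and g="\<lambda>s. (s\<^sup>2)\<^sup>2"])
      (use S4 moments in auto)
  have "(dev (Suc k) x)\<^sup>2 = (dev k x)\<^sup>2 + 2 * a * ((dev k x * (sig k x)\<^sup>2) * ((e k x)\<^sup>2 - 1))
      + a\<^sup>2 * (((sig k x)\<^sup>2)\<^sup>2 * ((e k x)\<^sup>2 - 1)\<^sup>2)" for x
    unfolding dev_Suc by (rule square_sum_scaled)
  with 1 2 Suc have D: "integrable M (\<lambda>x. (dev (Suc k) x)\<^sup>2)" by simp
  then have D1: "integrable M (dev (Suc k))"
    by (rule square_integrable_imp_integrable[rotated]) simp
  { case 1 show ?case by (rule D) }
  { case 2
    define m where "m = s0\<^sup>2 + \<omega> * real (Suc k)"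
    have "((sig (Suc k) x)\<^sup>2)\<^sup>2 = (dev (Suc k) x)\<^sup>2 + 2 * m * dev (Suc k) x + m\<^sup>2" for x
      unfolding dev_def m_def by (simp add: power2_eq_square algebra_simps)
    with D D1 show ?case by simp }
qed

text \<open>Martingale increments are orthogonal: by independence the cross term (\<open>p1\<close>)
  carries the factor \<open>E(e\<^sup>2 - 1) = 0\<close>, while the squared increment
  (\<open>p2\<close>) factors and its innovation part is at most \<open>c\<close>.\<close>

lemma expectation_dev_square_Suc:
  "expectation (\<lambda>x. (dev (Suc k) x)\<^sup>2) \<le>
     expectation (\<lambda>x. (dev k x)\<^sup>2) + a\<^sup>2 * c * expectation (\<lambda>x. ((sig k x)\<^sup>2)\<^sup>2)"
proof -
  note S4 = integrable_sig_pow4[of k]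
  have S2: "integrable M (\<lambda>x. (sig k x)\<^sup>2)"
    using S4 by (rule square_integrable_imp_integrable[rotated]) simp
  have xi: "integrable M (\<lambda>x. (e k x)\<^sup>2 - 1)" using moments by simp
  have DS: "integrable M (\<lambda>x. ((sig k x)\<^sup>2 - s0\<^sup>2 - \<omega> * real k) * (sig k x)\<^sup>2)"
    using S4 S2 by (simp add: left_diff_distrib flip: power2_eq_square)
  note p1 = integrable_sig_times_innovation expectation_sig_times_innovation
  note p1 = p1[where h="\<lambda>z. z\<^sup>2 - 1" and g="\<lambda>s. (s\<^sup>2 - s0\<^sup>2 - \<omega> * real k) * s\<^sup>2", OF _ _ DS xi]
  note p2 = integrable_sig_times_innovation expectation_sig_times_innovation
  note p2 = p2[where h="\<lambda>z. (z\<^sup>2 - 1)\<^sup>2" and g="\<lambda>s. (s\<^sup>2)\<^sup>2", OF _ _ S4 moments(3)]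
  have "(dev (Suc k) x)\<^sup>2 = (dev k x)\<^sup>2
      + 2 * a * (((sig k x)\<^sup>2 - s0\<^sup>2 - \<omega> * real k) * (sig k x)\<^sup>2 * ((e k x)\<^sup>2 - 1))
      + a\<^sup>2 * (((sig k x)\<^sup>2)\<^sup>2 * ((e k x)\<^sup>2 - 1)\<^sup>2)" for x
    unfolding dev_Suc square_sum_scaled by (simp add: dev_def)
  then have "expectation (\<lambda>x. (dev (Suc k) x)\<^sup>2) = expectation (\<lambda>x. (dev k x)\<^sup>2)
      + a\<^sup>2 * (expectation (\<lambda>x. ((sig k x)\<^sup>2)\<^sup>2) * expectation (\<lambda>x. ((e k x)\<^sup>2 - 1)\<^sup>2))"
    using p1 p2 integrable_dev_square expectation_centered by simp
  also have "\<dots> \<le> expectation (\<lambda>x. (dev k x)\<^sup>2) + a\<^sup>2 * (expectation (\<lambda>x. ((sig k x)\<^sup>2)\<^sup>2) * c)"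
    using moments(4)[of k] by (intro add_left_mono mult_left_mono) auto
  finally show ?thesis by (simp add: mult_ac)
qed

lemma variance_bound_nonneg: "c \<ge> 0"
proof -
  have "0 \<le> expectation (\<lambda>x. ((e 0 x)\<^sup>2 - 1)\<^sup>2)" by simp
  with moments(4)[of 0] show ?thesis by linarith
qed

text \<open>A discrete Gronwall argument. With \<open>q = 2 * a\<^sup>2 * c\<close> and
  \<open>m\<close> the mean at the horizon \<open>n\<close>, the second moment satisfies
  \<open>v' \<le> (1 + q) * v + q * m\<^sup>2\<close> and starts at 0; the right-hand side solves
  the corresponding equality.\<close>

lemma expectation_dev_square_le_power:
  assumes "k \<le> n"
  shows "expectation (\<lambda>x. (dev k x)\<^sup>2) \<le> ((1 + 2 * a\<^sup>2 * c) ^ k - 1) * (s0\<^sup>2 + \<omega> * real n)\<^sup>2"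
  using assms
proof (induction k)
  case 0
  show ?case by (simp add: dev_def sig_def)
next
  case (Suc k)
  define q m where "q = 2 * a\<^sup>2 * c" and "m = s0\<^sup>2 + \<omega> * real n"
  define v where "v = expectation (\<lambda>x. (dev k x)\<^sup>2)"
  have "q \<ge> 0" using variance_bound_nonneg by (simp add: q_def)
  have "expectation (\<lambda>x. ((sig k x)\<^sup>2)\<^sup>2) \<le> expectation (\<lambda>x. 2 * (dev k x)\<^sup>2 + 2 * m\<^sup>2)"
  proof (intro integral_mono integrable_sig_pow4)
    show "integrable M (\<lambda>x. 2 * (dev k x)\<^sup>2 + 2 * m\<^sup>2)" using integrable_dev_square by simp
    fix x
    \<comment> \<open>The mean at time \<open>k\<close> is at most the mean at the horizon, which
      makes the recursion uniform in \<open>k\<close>.\<close>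
    define l where "l = s0\<^sup>2 + \<omega> * real k"
    have "0 \<le> l" "l \<le> m" using coeffs Suc.prems by (auto simp: l_def m_def)
    then have "l\<^sup>2 \<le> m\<^sup>2" by (simp add: power_mono)
    moreover have "(sig k x)\<^sup>2 = dev k x + l" by (simp add: dev_def l_def)
    then have "((sig k x)\<^sup>2)\<^sup>2 \<le> 2 * (dev k x)\<^sup>2 + 2 * l\<^sup>2"
      using sum_squares_bound[of "dev k x" l] by (simp add: power2_sum)
    ultimately show "((sig k x)\<^sup>2)\<^sup>2 \<le> 2 * (dev k x)\<^sup>2 + 2 * m\<^sup>2" by linarith
  qed
  also have "\<dots> = 2 * v + 2 * m\<^sup>2" using integrable_dev_square by (simp add: v_def prob_space)
  finally have "a\<^sup>2 * c * expectation (\<lambda>x. ((sig k x)\<^sup>2)\<^sup>2) \<le> a\<^sup>2 * c * (2 * v + 2 * m\<^sup>2)"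
    using variance_bound_nonneg by (intro mult_left_mono) auto
  then have "expectation (\<lambda>x. (dev (Suc k) x)\<^sup>2) \<le> v * (1 + q) + q * m\<^sup>2"
    using expectation_dev_square_Suc[of k] by (simp add: v_def q_def algebra_simps)
  also have "\<dots> \<le> ((1 + q) ^ k - 1) * m\<^sup>2 * (1 + q) + q * m\<^sup>2"
    using Suc \<open>q \<ge> 0\<close> by (intro add_right_mono mult_right_mono) (auto simp: v_def q_def m_def)
  also have "\<dots> = ((1 + q) ^ Suc k - 1) * m\<^sup>2" by (simp add: algebra_simps)
  finally show ?case by (simp add: q_def m_def)
qed

text \<open>Follows from \<open>1 + q \<le> exp q\<close>. The exponent is a multiple of
  \<open>a\<^sup>2 * n\<close>, so the bound is of smaller order than the square of \<open>n\<close>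
  as soon as that product tends to 0.\<close>

lemma expectation_dev_square_le:
  assumes "k \<le> n"
  shows "expectation (\<lambda>x. (dev k x)\<^sup>2) \<le> (exp (2 * a\<^sup>2 * c * real n) - 1) * (s0\<^sup>2 + \<omega> * real n)\<^sup>2"
proof -
  define q where "q = 2 * a\<^sup>2 * c"
  have "q \<ge> 0" using variance_bound_nonneg by (simp add: q_def)
  have "(1 + q) ^ k \<le> exp q ^ k"
    using \<open>q \<ge> 0\<close> by (intro power_mono exp_ge_add_one_self) auto
  also have "\<dots> = exp (q * real k)" by (metis exp_of_nat_mult mult.commute)
  also have "\<dots> \<le> exp (q * real n)" using \<open>q \<ge> 0\<close> assms by (simp add: mult_left_mono)
  finally have "((1 + q) ^ k - 1) * (s0\<^sup>2 + \<omega> * real n)\<^sup>2 \<le> (exp (q * real n) - 1) * (s0\<^sup>2 + \<omega> * real n)\<^sup>2"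
    by (intro mult_right_mono) auto
  with expectation_dev_square_le_power[OF assms] show ?thesis by (simp add: q_def)
qed

text \<open>The difference is \<open>e k\<close> times the relative error of the volatility. By
  independence and the unit second moment of \<open>e k\<close>, only the mean square of that
  relative error remains.\<close>

lemma
  assumes k: "k > 0" "k \<le> n"
  defines "Z \<equiv> \<lambda>x. ((\<omega> * real k) powr (- 1/2) * garch_y \<omega> a b s0 (\<lambda>i. e i x) k - e k x)\<^sup>2"
  shows integrable_normalized_y: "integrable M Z"
    and expectation_normalized_y: "expectation Z \<le>
      2 * ((exp (2 * a\<^sup>2 * c * real n) - 1) * (s0\<^sup>2 + \<omega> * real n)\<^sup>2 + s0 ^ 4) / (\<omega> * real k)\<^sup>2"
proof -
  define l where "l = \<omega> * real k"
  have "l > 0" using coeffs k by (simp add: l_def)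
  define r where "r s = (s / sqrt l - 1)\<^sup>2" for s
  have powr: "l powr (- 1/2) = 1 / sqrt l"
    using \<open>l > 0\<close> by (simp add: powr_minus_divide powr_half_sqrt)
  have Z: "Z = (\<lambda>x. r (sig k x) * (e k x)\<^sup>2)"
    unfolding Z_def powr[unfolded l_def] r_def l_def
    by (simp add: garch_y_def sig_def power2_eq_square algebra_simps)
  have bound: "r (sig k x) \<le> (2 * (dev k x)\<^sup>2 + 2 * s0 ^ 4) / l\<^sup>2" for x
  proof -
    \<comment> \<open>For \<open>u \<ge> 0\<close> the factor \<open>u + 1\<close> is at least 1, so
      the error of the root is at most the error of the square. Nonnegativity needs
      \<open>k > 0\<close>, since \<open>s0\<close> may be negative.\<close>
    define u where "u = sig k x / sqrt l"
    have "u \<ge> 0" using garch_sigma_nonneg[of k \<omega> a b s0] k coeffs \<open>l > 0\<close> by (simp add: u_def sig_def)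
    then have "\<bar>u - 1\<bar> * 1 \<le> \<bar>u - 1\<bar> * \<bar>u + 1\<bar>" by (intro mult_left_mono) auto
    also have "\<dots> = \<bar>u\<^sup>2 - 1\<bar>" by (simp add: power2_eq_square algebra_simps flip: abs_mult)
    finally have "(u - 1)\<^sup>2 \<le> (u\<^sup>2 - 1)\<^sup>2" by (simp add: abs_le_square_iff)
    \<comment> \<open>The normalisation \<open>\<omega> * k\<close> omits the initial value from the
      mean, which leaves the additional \<open>s0\<^sup>2\<close>.\<close>
    also have "u\<^sup>2 - 1 = (dev k x + s0\<^sup>2) / l"
      using \<open>l > 0\<close> by (simp add: u_def dev_def flip: l_def) (simp add: power_divide field_simps)
    also have "((dev k x + s0\<^sup>2) / l)\<^sup>2 \<le> (2 * (dev k x)\<^sup>2 + 2 * s0 ^ 4) / l\<^sup>2"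
      using sum_squares_bound[of "dev k x" "s0\<^sup>2"]
      by (simp add: power_divide power2_sum divide_right_mono flip: power_mult)
    finally show ?thesis by (simp add: r_def u_def)
  qed
  have bi: "integrable M (\<lambda>x. (2 * (dev k x)\<^sup>2 + 2 * s0 ^ 4) / l\<^sup>2)"
    using integrable_dev_square by simp
  have [measurable]: "r \<in> borel_measurable borel" unfolding r_def by measurable
  have ri: "integrable M (\<lambda>x. r (sig k x))"
    by (rule Bochner_Integration.integrable_bound[OF bi])
      (use bound in \<open>auto simp: r_def intro!: AE_I2 order_trans[OF _ abs_ge_self]\<close>)
  show "integrable M Z" unfolding Z
    by (rule integrable_sig_times_innovation[OF _ _ ri]) (use moments in auto)
  have "expectation Z = expectation (\<lambda>x. r (sig k x))"
    unfolding Z using expectation_sig_times_innovation[of r "\<lambda>z. z\<^sup>2", OF _ _ ri] moments by simp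
  also have "\<dots> \<le> expectation (\<lambda>x. (2 * (dev k x)\<^sup>2 + 2 * s0 ^ 4) / l\<^sup>2)"
    using bound by (intro integral_mono ri bi)
  also have "\<dots> = (2 * expectation (\<lambda>x. (dev k x)\<^sup>2) + 2 * s0 ^ 4) / l\<^sup>2"
    using integrable_dev_square by (simp add: prob_space)
  also have "\<dots> \<le> (2 * ((exp (2 * a\<^sup>2 * c * real n) - 1) * (s0\<^sup>2 + \<omega> * real n)\<^sup>2) + 2 * s0 ^ 4) / l\<^sup>2"
    using expectation_dev_square_le[OF k(2)] by (intro divide_right_mono) auto
  finally show "expectation Z \<le>
      2 * ((exp (2 * a\<^sup>2 * c * real n) - 1) * (s0\<^sup>2 + \<omega> * real n)\<^sup>2 + s0 ^ 4) / (\<omega> * real k)\<^sup>2"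
    by (simp add: l_def distrib_left)
qed

end

section \<open>Laws and moments of identically distributed innovations\<close>

lemma (in prob_space) distr_iid_reindex:
  fixes e :: "nat \<Rightarrow> 'a \<Rightarrow> 'b :: topological_space"
  assumes "indep_vars (\<lambda>_. borel) e UNIV" "\<And>k. distr M borel (e k) = D" "inj_on h I"
  shows "distr M (\<Pi>\<^sub>M i\<in>I. borel) (\<lambda>x. \<lambda>i\<in>I. e (h i) x) = (\<Pi>\<^sub>M i\<in>I. D)"
proof -
  have rv [measurable]: "random_variable borel (e k)" for k
    using assms(1) unfolding indep_vars_def by auto
  have D: "prob_space D" using prob_space_distr[OF rv, of 0] assms(2) by simp
  have sets_D [measurable_cong]: "sets D = sets borel" using assms(2)[of 0] by auto
  \<comment> \<open>The whole sequence has an infinite product law, and selecting coordinates by an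
    injective map turns a product of copies of \<open>D\<close> into a product of copies of
    \<open>D\<close>.\<close>
  have "(\<Pi>\<^sub>M i\<in>I. D) = distr (\<Pi>\<^sub>M k\<in>UNIV. D) (\<Pi>\<^sub>M i\<in>I. D) (\<lambda>z. \<lambda>i\<in>I. z (h i))"
    using distr_PiM_reindex[of UNIV "\<lambda>_. D" h I] D assms(3) by simp
  also have "(\<Pi>\<^sub>M k\<in>UNIV. D) = distr M (\<Pi>\<^sub>M k\<in>UNIV. borel) (\<lambda>x. \<lambda>k\<in>UNIV. e k x)"
    using assms(1,2) by (subst (asm) indep_vars_iff_distr_eq_PiM) auto
  also have "distr \<dots> (\<Pi>\<^sub>M i\<in>I. D) (\<lambda>z. \<lambda>i\<in>I. z (h i)) =
      distr M (\<Pi>\<^sub>M i\<in>I. D) (\<lambda>x. \<lambda>i\<in>I. e (h i) x)"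
    by (subst distr_distr) (auto simp: o_def cong: measurable_cong_sets sets_PiM_cong intro!: measurable_restrict)
  also have "\<dots> = distr M (\<Pi>\<^sub>M i\<in>I. borel) (\<lambda>x. \<lambda>i\<in>I. e (h i) x)"
    by (rule distr_cong) (auto intro!: sets_PiM_cong sets_D)
  finally show ?thesis by simp
qed

lemma
  fixes X Y :: "'a \<Rightarrow> 'b::topological_space" and g :: "'b \<Rightarrow> real"
  assumes "distr M borel X = distr M borel Y"
    and [measurable]: "X \<in> borel_measurable M" "Y \<in> borel_measurable M" "g \<in> borel_measurable borel"
  shows integrable_eq_if_distr_eq: "integrable M (\<lambda>x. g (X x)) \<longleftrightarrow> integrable M (\<lambda>x. g (Y x))"
    and integral_eq_if_distr_eq: "(\<integral>x. g (X x) \<partial>M) = (\<integral>x. g (Y x) \<partial>M)"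
  using integrable_distr_eq[of X M borel g] integrable_distr_eq[of Y M borel g]
    integral_distr[of X M borel g] integral_distr[of Y M borel g] assms by auto

section \<open>Sampling times and the limit of the error bound\<close>

lemma floor_scaled_ge_half:
  fixes t :: real
  assumes "t > 0"
  shows "\<forall>\<^sub>F n in sequentially. 0 < nat \<lfloor>real n * t\<rfloor> \<and> real n * t / 2 \<le> real (nat \<lfloor>real n * t\<rfloor>)"
  \<comment> \<open>From this index on \<open>real n * t \<ge> 2\<close>, so that the integer part,
    which loses less than 1, keeps at least half.\<close>
  using eventually_ge_at_top[of "nat \<lceil>2 / t\<rceil>"]
proof eventually_elim
  case (elim n)
  then have "2 / t \<le> real n" by linarith
  then have "2 \<le> real n * t" using assms by (simp add: field_simps)
  then show ?case by linarith
qed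

lemma floor_scaled_neq:
  fixes s t :: real
  assumes "s > 0" "t > 0" "s \<noteq> t"
  shows "\<forall>\<^sub>F n in sequentially. nat \<lfloor>real n * s\<rfloor> \<noteq> nat \<lfloor>real n * t\<rfloor>"
  \<comment> \<open>From this index on the scaled points are at least 1 apart, hence their integer
    parts differ.\<close>
  using eventually_ge_at_top[of "nat \<lceil>1 / \<bar>s - t\<bar>\<rceil>"]
proof eventually_elim
  case (elim n)
  then have "1 / \<bar>s - t\<bar> \<le> real n" by linarith
  then have "1 \<le> real n * \<bar>s - t\<bar>" using assms by (simp add: field_simps)
  also have "\<dots> = \<bar>real n * s - real n * t\<bar>" by (simp add: abs_mult flip: right_diff_distrib)
  finally have "1 \<le> \<bar>real n * s - real n * t\<bar>" .
  moreover have "0 \<le> real n * s" "0 \<le> real n * t" using assms by simp_all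
  ultimately show ?case by linarith
qed

lemma normalized_y_bound_tendsto_0:
  fixes s0 \<omega> c t :: real
  assumes "\<omega> > 0" "t > 0" and a: "(\<lambda>n. real n powr (1/2) * a n) \<longlonglongrightarrow> 0"
  shows "(\<lambda>n. 2 * ((exp (2 * (a n)\<^sup>2 * c * real n) - 1) * (s0\<^sup>2 + \<omega> * real n)\<^sup>2 + s0 ^ 4) /
    (\<omega> * (real n * t / 2))\<^sup>2) \<longlonglongrightarrow> 0"
proof -
  define p where "p = \<omega> * t / 2"
  define u where "u n = 1 / real n" for n
  have "p > 0" using assms by (simp add: p_def)
  have u: "u \<longlonglongrightarrow> 0" unfolding u_def by (rule lim_1_over_n)
  \<comment> \<open>The rate assumption enters in squared form, as convergence to 0 of the exponent
    up to a constant.\<close>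
  have "(\<lambda>n. (real n powr (1/2) * a n)\<^sup>2) \<longlonglongrightarrow> 0\<^sup>2" by (intro tendsto_intros a)
  then have na2: "(\<lambda>n. (a n)\<^sup>2 * real n) \<longlonglongrightarrow> 0"
    by (simp add: powr_half_sqrt power_mult_distrib mult.commute)
  \<comment> \<open>Numerator and denominator are divided by the square of \<open>n\<close>; the
    expression then depends continuously on two null sequences. The two forms agree for
    \<open>n > 0\<close>.\<close>
  have "(\<lambda>n. 2 * ((exp (2 * c * ((a n)\<^sup>2 * real n)) - 1) * (s0\<^sup>2 * u n + \<omega>)\<^sup>2 + s0 ^ 4 * (u n)\<^sup>2) / p\<^sup>2)
      \<longlonglongrightarrow> 2 * ((exp (2 * c * 0) - 1) * (s0\<^sup>2 * 0 + \<omega>)\<^sup>2 + s0 ^ 4 * 0\<^sup>2) / p\<^sup>2"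
    using \<open>p > 0\<close> by (intro tendsto_intros u na2) auto
  then have "(\<lambda>n. 2 * ((exp (2 * c * ((a n)\<^sup>2 * real n)) - 1) * (s0\<^sup>2 * u n + \<omega>)\<^sup>2 + s0 ^ 4 * (u n)\<^sup>2) / p\<^sup>2)
      \<longlonglongrightarrow> 0" by simp
  then show ?thesis
  proof (rule Lim_transform_eventually)
    show "\<forall>\<^sub>F n in sequentially.
      2 * ((exp (2 * c * ((a n)\<^sup>2 * real n)) - 1) * (s0\<^sup>2 * u n + \<omega>)\<^sup>2 + s0 ^ 4 * (u n)\<^sup>2) / p\<^sup>2 =
      2 * ((exp (2 * (a n)\<^sup>2 * c * real n) - 1) * (s0\<^sup>2 + \<omega> * real n)\<^sup>2 + s0 ^ 4) /
        (\<omega> * (real n * t / 2))\<^sup>2"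
      using eventually_gt_at_top[of 0]
    proof eventually_elim
      case (elim n)
      define E where "E = exp (2 * c * ((a n)\<^sup>2 * real n)) - 1"
      have E: "exp (2 * (a n)\<^sup>2 * c * real n) - 1 = E" by (simp add: E_def mult_ac)
      have su: "s0\<^sup>2 * u n + \<omega> = (s0\<^sup>2 + \<omega> * real n) / real n"
        using elim by (simp add: u_def field_simps)
      have p: "\<omega> * (real n * t / 2) = p * real n" by (simp add: p_def)
      have "2 * (E * (z / real n)\<^sup>2 + w * (1 / real n)\<^sup>2) / p\<^sup>2 =
          2 * (E * z\<^sup>2 + w) / (p * real n)\<^sup>2" for z w
        using elim \<open>p > 0\<close> by (simp add: power_divide power_mult_distrib divide_simps)
      then show ?case
        unfolding E E_def[symmetric] su p unfolding u_def .
    qed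
  qed
qed

text \<open>Where the fourth power exceeds 1 it is dominated by the higher power, and the constant 1
  is integrable on a probability space.\<close>

lemma (in prob_space) integrable_pow4_if_higher_moment:
  fixes X :: "'a \<Rightarrow> real"
  assumes [measurable]: "X \<in> borel_measurable M" and "integrable M (\<lambda>x. \<bar>X x\<bar> powr (4 + \<delta>))" "\<delta> \<ge> 0"
  shows "integrable M (\<lambda>x. X x ^ 4)"
proof (rule Bochner_Integration.integrable_bound)
  show "integrable M (\<lambda>x. 1 + \<bar>X x\<bar> powr (4 + \<delta>))" using assms by simp
  have "\<bar>z\<bar> ^ 4 \<le> 1 + \<bar>z\<bar> powr (4 + \<delta>)" for z :: real
  proof (cases "\<bar>z\<bar> \<le> 1")
    case True
    then have "\<bar>z\<bar> ^ 4 \<le> 1" by (intro power_le_one) auto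
    then show ?thesis using powr_ge_zero[of "\<bar>z\<bar>" "4 + \<delta>"] by linarith
  next
    case False
    then have "\<bar>z\<bar> ^ 4 = \<bar>z\<bar> powr 4" by simp
    also have "\<dots> \<le> \<bar>z\<bar> powr (4 + \<delta>)" using False \<open>\<delta> \<ge> 0\<close> by (intro powr_mono) auto
    finally show ?thesis by simp
  qed
  then show "AE x in M. norm (X x ^ 4) \<le> norm (1 + \<bar>X x\<bar> powr (4 + \<delta>))"
    by (simp add: power_abs)
qed simp

section \<open>Joint convergence of the normalised observations\<close>

theorem theorem2p4:
  fixes M :: "'a measure"
    and \<epsilon> :: "nat \<Rightarrow> 'a \<Rightarrow> real"
    and \<omega> \<sigma>0 \<delta> :: real
    and \<alpha> \<beta> :: "nat \<Rightarrow> real"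
    and N :: nat and t :: "nat \<Rightarrow> real"
  assumes "prob_space M"
    and "prob_space.indep_vars M (\<lambda>_. borel) \<epsilon> UNIV"
    and "\<And>k. distr M borel (\<epsilon> k) = distr M borel (\<epsilon> 0)"
    and "\<not> (\<exists>c. AE x in M. (\<epsilon> 0 x)\<^sup>2 = c)"
    and "\<omega> > 0"
    and "\<And>n. n \<ge> 1 \<Longrightarrow> \<alpha> n \<ge> 0"
    and "\<And>n. n \<ge> 1 \<Longrightarrow> \<beta> n \<ge> 0"
    and "\<alpha> \<longlonglongrightarrow> 0"
    and "\<beta> \<longlonglongrightarrow> 1"
    and "\<And>n. n \<ge> 1 \<Longrightarrow> \<alpha> n + \<beta> n - 1 = 0"
    and "integrable M (\<lambda>x. (\<epsilon> 0 x)\<^sup>2)"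
    and "(\<integral>x. (\<epsilon> 0 x)\<^sup>2 \<partial>M) = 1"
    and "\<delta> > 0"
    and "integrable M (\<lambda>x. \<bar>\<epsilon> 0 x\<bar> powr (4 + \<delta>))"
    and "(\<lambda>n. real n powr (1/2) * \<alpha> n) \<longlonglongrightarrow> 0"
    and "filterlim (\<lambda>n. real n * \<alpha> n) at_top sequentially"
    and "N \<ge> 1"
    and "0 < t 1"
    and "strict_mono_on {1..N} t"
    and "t N \<le> 1"
  shows "weak_conv_in (product_topology (\<lambda>_. euclideanreal) {1..N})
     (\<lambda>n. distr M (\<Pi>\<^sub>M m\<in>{1..N}. borel)
        (\<lambda>x. \<lambda>m\<in>{1..N}.
           (\<omega> * real (nat \<lfloor>real n * t m\<rfloor>)) powr (- 1/2) *
           garch_y \<omega> (\<alpha> n) (\<beta> n) \<sigma>0 (\<lambda>k. \<epsilon> k x) (nat \<lfloor>real n * t m\<rfloor>)))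
     (\<Pi>\<^sub>M m\<in>{1..N}. distr M borel (\<epsilon> 0))"
proof -
  interpret prob_space M by (rule assms(1))
  note indep = assms(2) and law0 = assms(3)
  have rv [measurable]: "\<epsilon> k \<in> borel_measurable M" for k
    using indep unfolding indep_vars_def by auto
  \<comment> \<open>The variance of the squared innovation, finite by the fourth moment and the same
    for all indices; it does not depend on \<open>n\<close>.\<close>
  define c where "c = expectation (\<lambda>x. ((\<epsilon> 0 x)\<^sup>2 - 1)\<^sup>2)"
  have "integrable M (\<lambda>x. \<epsilon> 0 x ^ 4)"
    using integrable_pow4_if_higher_moment[OF rv assms(14)] assms(13) by simp
  moreover have "((\<epsilon> 0 x)\<^sup>2 - 1)\<^sup>2 = \<epsilon> 0 x ^ 4 - 2 * (\<epsilon> 0 x)\<^sup>2 + 1" for x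
    by (simp add: power2_eq_square power4_eq_xxxx algebra_simps)
  ultimately have int4: "integrable M (\<lambda>x. ((\<epsilon> 0 x)\<^sup>2 - 1)\<^sup>2)"
    using assms(11) by simp
  have m1: "integrable M (\<lambda>x. (\<epsilon> k x)\<^sup>2)" "expectation (\<lambda>x. (\<epsilon> k x)\<^sup>2) = 1" for k
    using integrable_eq_if_distr_eq[OF law0[of k], of "\<lambda>z. z\<^sup>2"]
      integral_eq_if_distr_eq[OF law0[of k], of "\<lambda>z. z\<^sup>2"] assms(11,12) by simp_all
  have m2: "integrable M (\<lambda>x. ((\<epsilon> k x)\<^sup>2 - 1)\<^sup>2)" "expectation (\<lambda>x. ((\<epsilon> k x)\<^sup>2 - 1)\<^sup>2) \<le> c" for k
    using integrable_eq_if_distr_eq[OF law0[of k], of "\<lambda>z. (z\<^sup>2 - 1)\<^sup>2"]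
      integral_eq_if_distr_eq[OF law0[of k], of "\<lambda>z. (z\<^sup>2 - 1)\<^sup>2"] int4 by (simp_all add: c_def)
  \<comment> \<open>The initial value occurs in no locale assumption, so the predicate has no
    argument for it; it is supplied at the interpretation.\<close>
  have garch: "critical_garch M \<epsilon> \<omega> (\<alpha> n) (\<beta> n) c" if "n \<ge> 1" for n
    using indep m1 m2 assms(5) assms(6,7,10)[OF that] by unfold_locales auto
  have t: "0 < t m" "t m \<le> 1" if "m \<in> {1..N}" for m
  proof -
    have "t 1 \<le> t m" "t m \<le> t N"
      using strict_mono_on_leD[OF assms(19)] that by auto
    then show "0 < t m" "t m \<le> 1" using assms(18,20) by auto
  qed
  define k where "k n m = nat \<lfloor>real n * t m\<rfloor>" for n m
  \<comment> \<open>The comparison vector: it has exactly the limit law once the sampling times are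
    distinct.\<close>
  define X where "X n m = \<epsilon> (k n m)" for n m
  define Y where "Y n m x = (\<omega> * real (k n m)) powr (- 1/2) *
    garch_y \<omega> (\<alpha> n) (\<beta> n) \<sigma>0 (\<lambda>j. \<epsilon> j x) (k n m)" for n m x
  have k_le: "k n m \<le> n" if "m \<in> {1..N}" for n m
  proof -
    have "real n * t m \<le> real n" using t[OF that] by (simp add: mult_left_le)
    then show ?thesis unfolding k_def by linarith
  qed
  have [measurable]: "Y n m \<in> borel_measurable M" for n m
    unfolding Y_def[abs_def] garch_y_def
    by (intro borel_measurable_times measurable_garch_sigma) auto
  have close: "\<forall>\<^sub>F n in sequentially. integrable M (\<lambda>x. (Y n m x - X n m x)\<^sup>2) \<and>
      expectation (\<lambda>x. (Y n m x - X n m x)\<^sup>2) \<le>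
        2 * ((exp (2 * (\<alpha> n)\<^sup>2 * c * real n) - 1) * (\<sigma>0\<^sup>2 + \<omega> * real n)\<^sup>2 + \<sigma>0 ^ 4) /
        (\<omega> * (real n * t m / 2))\<^sup>2"
    if m: "m \<in> {1..N}" for m
    using floor_scaled_ge_half[OF t(1)[OF m]] eventually_ge_at_top[of 1]
  proof eventually_elim
    case (elim n)
    interpret critical_garch M \<epsilon> \<omega> "\<alpha> n" "\<beta> n" \<sigma>0 c by (rule garch) fact
    have k: "k n m > 0" "real n * t m / 2 \<le> real (k n m)" using elim by (auto simp: k_def)
    let ?A = "2 * ((exp (2 * (\<alpha> n)\<^sup>2 * c * real n) - 1) * (\<sigma>0\<^sup>2 + \<omega> * real n)\<^sup>2 + \<sigma>0 ^ 4)"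
    have "expectation (\<lambda>x. (Y n m x - X n m x)\<^sup>2) \<le> ?A / (\<omega> * real (k n m))\<^sup>2"
      using expectation_normalized_y[OF k(1) k_le[OF m]] by (simp add: X_def Y_def)
    \<comment> \<open>Replacing the integer part by its lower bound \<open>real n * t m / 2\<close>
      gives an expression without rounding, whose limit is already known.\<close>
    also have "\<dots> \<le> ?A / (\<omega> * (real n * t m / 2))\<^sup>2"
    proof (rule divide_left_mono)
      have "0 < real n * t m / 2" using t[OF m] elim by simp
      then have pos: "0 < \<omega> * (real n * t m / 2)" using assms(5) by (rule mult_pos_pos[rotated])
      show "(\<omega> * (real n * t m / 2))\<^sup>2 \<le> (\<omega> * real (k n m))\<^sup>2"
        using pos k(2) assms(5) by (intro power_mono mult_left_mono) linarith+
      show "0 < (\<omega> * real (k n m))\<^sup>2 * (\<omega> * (real n * t m / 2))\<^sup>2"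
        using pos k(1) assms(5) by (intro mult_pos_pos[OF zero_less_power zero_less_power]) simp_all
      have "0 \<le> 2 * (\<alpha> n)\<^sup>2 * c * real n" using variance_bound_nonneg by simp
      then have "0 \<le> exp (2 * (\<alpha> n)\<^sup>2 * c * real n) - 1" by simp
      then show "0 \<le> ?A"
        by (intro mult_nonneg_nonneg add_nonneg_nonneg) simp_all
    qed
    finally show ?case
      using integrable_normalized_y[OF k(1) k_le[OF m]] by (simp add: X_def Y_def)
  qed
  have "weak_conv_in (product_topology (\<lambda>_. euclideanreal) {1..N})
    (\<lambda>n. distr M (\<Pi>\<^sub>M m\<in>{1..N}. borel) (\<lambda>x. \<lambda>m\<in>{1..N}. Y n m x))
    (\<Pi>\<^sub>M m\<in>{1..N}. distr M borel (\<epsilon> 0))"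
  proof (rule weak_conv_in_L2_perturbation[where X=X and C=1])
    \<comment> \<open>Each pair of sampling times separates eventually, and there are only finitely
      many pairs, so all of them are distinct simultaneously for large \<open>n\<close>.\<close>
    have "\<forall>\<^sub>F n in sequentially. m \<noteq> m' \<longrightarrow> k n m \<noteq> k n m'"
      if m: "m \<in> {1..N}" "m' \<in> {1..N}" for m m'
    proof (cases "m = m'")
      case False
      have "inj_on t {1..N}" using assms(19) by (rule strict_mono_on_imp_inj_on)
      then have "t m \<noteq> t m'" using m False by (metis inj_onD)
      from floor_scaled_neq[OF t(1)[OF m(1)] t(1)[OF m(2)] this] show ?thesis
        unfolding k_def by (rule eventually_mono) simp
    qed simp
    then have "\<forall>\<^sub>F n in sequentially. \<forall>m\<in>{1..N}. \<forall>m'\<in>{1..N}. m \<noteq> m' \<longrightarrow> k n m \<noteq> k n m'"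
      by (simp add: eventually_ball_finite_distrib)
    then show "\<forall>\<^sub>F n in sequentially. distr M (\<Pi>\<^sub>M m\<in>{1..N}. borel) (\<lambda>x. \<lambda>m\<in>{1..N}. X n m x) =
        (\<Pi>\<^sub>M m\<in>{1..N}. distr M borel (\<epsilon> 0))"
    proof eventually_elim
      case (elim n)
      then have "inj_on (k n) {1..N}" unfolding inj_on_def by metis
      then show ?case unfolding X_def by (rule distr_iid_reindex[OF indep law0])
    qed
    show "\<forall>\<^sub>F n in sequentially. \<forall>m\<in>{1..N}. integrable M (\<lambda>x. (Y n m x - X n m x)\<^sup>2)"
    proof (rule eventually_ball_finite[OF finite_atLeastAtMost], rule ballI)
      show "\<forall>\<^sub>F n in sequentially. integrable M (\<lambda>x. (Y n m x - X n m x)\<^sup>2)"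
        if "m \<in> {1..N}" for m
        using close[OF that] by eventually_elim simp
    qed
    show "(\<lambda>n. expectation (\<lambda>x. (Y n m x - X n m x)\<^sup>2)) \<longlonglongrightarrow> 0" if m: "m \<in> {1..N}" for m
    proof (rule tendsto_sandwich[OF _ _ tendsto_const])
      show "\<forall>\<^sub>F n in sequentially. expectation (\<lambda>x. (Y n m x - X n m x)\<^sup>2) \<le>
          2 * ((exp (2 * (\<alpha> n)\<^sup>2 * c * real n) - 1) * (\<sigma>0\<^sup>2 + \<omega> * real n)\<^sup>2 + \<sigma>0 ^ 4) /
          (\<omega> * (real n * t m / 2))\<^sup>2"
        using close[OF m] by eventually_elim simp
      show "(\<lambda>n. 2 * ((exp (2 * (\<alpha> n)\<^sup>2 * c * real n) - 1) * (\<sigma>0\<^sup>2 + \<omega> * real n)\<^sup>2 + \<sigma>0 ^ 4) /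
          (\<omega> * (real n * t m / 2))\<^sup>2) \<longlonglongrightarrow> 0"
        using assms(5) t(1)[OF m] assms(15) by (rule normalized_y_bound_tendsto_0)
    qed simp
  qed (simp_all add: X_def m1)
  then show ?thesis by (simp add: Y_def k_def)
qed

end
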